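(* Let $S$ be a nonempty commutative semigroup and $G$ a group. Let $f\in G\setminus\{1_G\}$ be an element of lc-height $\ge k$ (i.e. $f\in C^kG$) and let $f':S\to G$ be a polynomial map of lc-height $\ge k'$ and degree $\le d'$. Then the left $f$-translation $ff':t\mapsto f\,f'(t)$ and the right $f$-translation $f'f:t\mapsto f'(t)\,f$ are polynomial maps $S\to G$ of lc-height $\ge\min\{k,k'\}$ and degree $\le\max\{0,d'\}$.
   Context: The lower central series is $C^1G=G$, $C^{i+1}G=[C^iG,G]$. A function $S\to G$ has lc-height $\ge k$ if its image lies in $C^kG$; an element of $G$ is identified with the corresponding constant map. Let $S$ be a nonempty commutative semigroup (written additively) and $G$ a group with identity $1_G$. A map $f:S\to G$ is a polynomial map of degree $-\infty$ if $f(s)=1_G$ for all $s$, and of degree $0$ if it is constant with value different from $1_G$. Thus degree $\le 0$ means constant. Inductively, for $d\in\{0,1,2,\dots\}$, $f$ is a polynomial map of degree $\le d+1$ if for every $s\in S$ both maps $L_s(f):t\mapsto f(s+t)f(t)^{-1}$ and $R_s(f):t\mapsto f(t)^{-1}f(s+t)$ from $S$ to $G$ are polynomial maps of degree $\le d$. The degree of a polynomial map is the least such $d\in\{-\infty,0,1,2,\dots\}$. A map is a polynomial map if it is a polynomial map of degree $\le d$ for some $d$. *)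

theory Defs
  imports "HOL-Algebra.Generated_Groups" "HOL-Library.Option_ord"
begin

section \<open>Lower central series\<close>

definition commutator_subgroup ::
    "('g, 'b) monoid_scheme \<Rightarrow> 'g set \<Rightarrow> 'g set \<Rightarrow> 'g set" where
  "commutator_subgroup G H K =
     generate G (\<Union>h\<in>H. \<Union>k\<in>K. {h \<otimes>\<^bsub>G\<^esub> k \<otimes>\<^bsub>G\<^esub> inv\<^bsub>G\<^esub> h \<otimes>\<^bsub>G\<^esub> inv\<^bsub>G\<^esub> k})"

text \<open>The series starts at index 1; the value at index 0 is a dummy.\<close>

fun lower_central :: "('g, 'b) monoid_scheme \<Rightarrow> nat \<Rightarrow> 'g set" where
  "lower_central G 0 = carrier G"
| "lower_central G (Suc 0) = carrier G"
| "lower_central G (Suc (Suc i)) =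
     commutator_subgroup G (lower_central G (Suc i)) (carrier G)"

definition lc_height_ge :: "('g, 'b) monoid_scheme \<Rightarrow> nat \<Rightarrow> ('s \<Rightarrow> 'g) \<Rightarrow> bool" where
  "lc_height_ge G k f \<longleftrightarrow> range f \<subseteq> lower_central G k"


section \<open>Polynomial maps\<close>

definition left_diff ::
    "('g, 'b) monoid_scheme \<Rightarrow> 's::ab_semigroup_add \<Rightarrow> ('s \<Rightarrow> 'g) \<Rightarrow> 's \<Rightarrow> 'g" where
  "left_diff G s f = (\<lambda>t. f (s + t) \<otimes>\<^bsub>G\<^esub> inv\<^bsub>G\<^esub> (f t))"

definition right_diff ::
    "('g, 'b) monoid_scheme \<Rightarrow> 's::ab_semigroup_add \<Rightarrow> ('s \<Rightarrow> 'g) \<Rightarrow> 's \<Rightarrow> 'g" where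
  "right_diff G s f = (\<lambda>t. inv\<^bsub>G\<^esub> (f t) \<otimes>\<^bsub>G\<^esub> f (s + t))"

text \<open>
  Degrees lie in \<^typ>\<open>nat option\<close>: \<^term>\<open>None\<close> is minus infinity and
  \<^term>\<open>Some d\<close> is the natural number \<open>d\<close>. The order is that of
  \<^theory>\<open>HOL-Library.Option_ord\<close>, in which \<^term>\<open>None\<close> is the least element.
\<close>

function poly_map_deg_le ::
    "('g, 'b) monoid_scheme \<Rightarrow> nat option \<Rightarrow> ('s::ab_semigroup_add \<Rightarrow> 'g) \<Rightarrow> bool" where
  "poly_map_deg_le G None f \<longleftrightarrow>
     (\<forall>s. f s = \<one>\<^bsub>G\<^esub>)"
| "poly_map_deg_le G (Some 0) f \<longleftrightarrow>
     poly_map_deg_le G None f \<or> (\<exists>c\<in>carrier G. c \<noteq> \<one>\<^bsub>G\<^esub> \<and> (\<forall>s. f s = c))"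
| "poly_map_deg_le G (Some (Suc d)) f \<longleftrightarrow>
     range f \<subseteq> carrier G \<and>
     (\<forall>s. poly_map_deg_le G (Some d) (left_diff G s f) \<and>
          poly_map_deg_le G (Some d) (right_diff G s f))"
  by pat_completeness auto
termination
  by (relation "measure (\<lambda>(G, d, f). case d of None \<Rightarrow> 0 | Some n \<Rightarrow> Suc n)") auto

definition polynomial_map ::
    "('g, 'b) monoid_scheme \<Rightarrow> ('s::ab_semigroup_add \<Rightarrow> 'g) \<Rightarrow> bool" where
  "polynomial_map G f \<longleftrightarrow> (\<exists>d. poly_map_deg_le G d f)"

definition poly_degree ::
    "('g, 'b) monoid_scheme \<Rightarrow> ('s::ab_semigroup_add \<Rightarrow> 'g) \<Rightarrow> nat option" where
  "poly_degree G f = (LEAST d. poly_map_deg_le G d f)"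

lemma poly_map_deg_le_zero_iff:
  assumes "group G"
  shows "poly_map_deg_le G (Some 0) f \<longleftrightarrow> (\<exists>c\<in>carrier G. \<forall>s. f s = c)"
proof -
  interpret group G by fact
  show ?thesis by auto
qed

lemma poly_map_deg_le_Suc:
  assumes "group G" "poly_map_deg_le G (Some d) f"
  shows "poly_map_deg_le G (Some (Suc d)) f"
  using assms(2)
proof (induction d arbitrary: f)
  case 0
  interpret group G by fact
  from 0 obtain c where "c \<in> carrier G" "\<And>s. f s = c"
    using poly_map_deg_le_zero_iff[OF assms(1)] by blast
  then show ?case by (auto simp: left_diff_def right_diff_def)
next
  case (Suc d)
  have "range f \<subseteq> carrier G"
    and "poly_map_deg_le G (Some d) (left_diff G s f)"
    and "poly_map_deg_le G (Some d) (right_diff G s f)" for s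
    using Suc.prems by simp_all
  then show ?case
    using Suc.IH by (simp del: poly_map_deg_le.simps add: poly_map_deg_le.simps(3)[of G "Suc d"])
qed

lemma poly_map_deg_le_mono:
  assumes "group G" "poly_map_deg_le G d f" "d \<le> e"
  shows "poly_map_deg_le G e f"
proof -
  have step: "poly_map_deg_le G (Some n) f"
    if "m \<le> n" "poly_map_deg_le G (Some m) f" for m n
    using that by (induction rule: dec_induct) (blast intro: poly_map_deg_le_Suc[OF assms(1)])+
  show ?thesis
  proof (cases e)
    case None
    with assms show ?thesis by (cases d) auto
  next
    case e: (Some n)
    show ?thesis
    proof (cases d)
      case None
      with assms(2) have "poly_map_deg_le G (Some 0) f" by simp
      then show ?thesis using step[of 0 n] e by blast
    next
      case (Some m)
      then show ?thesis using step[of m n] e assms(2,3) by simp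
    qed
  qed
qed

lemma poly_map_deg_le_iff_degree:
  assumes "group G"
  shows "poly_map_deg_le G d f \<longleftrightarrow> polynomial_map G f \<and> poly_degree G f \<le> d"
  unfolding polynomial_map_def poly_degree_def
  by (meson LeastI Least_le assms poly_map_deg_le_mono)

end

theory Submission
  imports Defs
begin

text \<open>
  Multiplication by a constant leaves one of the two differences unchanged and conjugates the
  other: with \<open>F t = c \<cdot> f t\<close>, the right difference of \<open>F\<close> is that of \<open>f\<close>, and the left difference
  of \<open>F\<close> is that of \<open>f\<close> conjugated by \<open>c\<close>. Conjugation is an endomorphism of \<open>G\<close>, and composing
  with a homomorphism commutes with taking differences, so it preserves degree bounds
  (\<open>poly_map_deg_le_hom\<close>). Hence both differences of the left translate of a map of degree at most
  \<open>d + 1\<close> have degree at most \<open>d\<close>. A right translate is a conjugate of a left one. Degrees \<open>-\<infinity>\<close> and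
  \<open>0\<close> both mean constant, and a translate of a constant map is constant, but it can be nontrivial
  when the map is trivial; this is why the degree bound is a maximum with \<open>0\<close>.

  The height bound holds because the lower central series is a descending chain of subgroups.
\<close>

lemma (in group) commutator_subgroup_mono:
  "H \<subseteq> H' \<Longrightarrow> commutator_subgroup G H K \<subseteq> commutator_subgroup G H' K"
  unfolding commutator_subgroup_def by (rule mono_generate) blast

lemma (in group) subgroup_commutator_subgroup:
  assumes "H \<subseteq> carrier G" "K \<subseteq> carrier G"
  shows "subgroup (commutator_subgroup G H K) G"
  unfolding commutator_subgroup_def
  using assms by (intro generate_is_subgroup) (auto intro!: m_closed inv_closed)

lemma (in group) subgroup_lower_central:
  "subgroup (lower_central G k) G"
proof (induction k rule: induct_nat_012)
  case (ge2 n)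
  then show ?case
    by (simp add: subgroup_commutator_subgroup subgroup.subset)
qed (simp_all add: subgroup_self)

text \<open>
  The inclusion \<open>C^2 \<subseteq> C^1\<close> is trivial, and applying the monotone operation \<open>H \<mapsto> [H, G]\<close> to each
  inclusion gives the next one.
\<close>

lemma (in group) lower_central_Suc_subset:
  "lower_central G (Suc k) \<subseteq> lower_central G k"
proof (induction k rule: induct_nat_012)
  case 1
  show ?case
    using subgroup.subset[OF subgroup_lower_central[of "Suc (Suc 0)"]] by simp
next
  case (ge2 n)
  then show ?case
    by (simp only: lower_central.simps(3) commutator_subgroup_mono)
qed simp

lemma (in group) lower_central_antimono:
  "i \<le> j \<Longrightarrow> lower_central G j \<subseteq> lower_central G i"
  by (rule lift_Suc_antimono_le[of "lower_central G", OF lower_central_Suc_subset])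

lemma lc_height_ge_antimono:
  assumes "group G" "lc_height_ge G j f" "i \<le> j"
  shows "lc_height_ge G i f"
  using assms group.lower_central_antimono[of G i j] unfolding lc_height_ge_def by blast

lemma lc_height_ge_mult:
  assumes "group G" "lc_height_ge G k f" "lc_height_ge G k g"
  shows "lc_height_ge G k (\<lambda>t. f t \<otimes>\<^bsub>G\<^esub> g t)"
  using assms group.subgroup_lower_central[of G k] unfolding lc_height_ge_def
  by (auto intro: subgroup.m_closed)

lemma poly_map_deg_le_closed:
  assumes "group G" "poly_map_deg_le G d f"
  shows "f t \<in> carrier G"
proof -
  interpret group G by fact
  show ?thesis
    using assms(2) by (cases "(G, d, f)" rule: poly_map_deg_le.cases) auto
qed

lemma poly_map_deg_le_hom:
  assumes "group G" "group H" "h \<in> hom G H" "poly_map_deg_le G d f"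
  shows "poly_map_deg_le H d (\<lambda>t. h (f t))"
proof -
  interpret h: group_hom G H h
    using assms(1-3) by (simp add: group_hom_def group_hom_axioms_def)
  have finite_degree: "poly_map_deg_le H (Some n) (\<lambda>t. h (f t))"
    if "poly_map_deg_le G (Some n) f" for n f
    using that
  proof (induction n arbitrary: f)
    case 0
    then show ?case
      by (auto simp: poly_map_deg_le_zero_iff h.group_axioms h.H.group_axioms
          simp del: poly_map_deg_le.simps)
  next
    case (Suc n)
    have f: "f t \<in> carrier G" for t
      using poly_map_deg_le_closed[OF assms(1) Suc.prems] .
    have "left_diff H s (\<lambda>t. h (f t)) = (\<lambda>t. h (left_diff G s f t))"
      and "right_diff H s (\<lambda>t. h (f t)) = (\<lambda>t. h (right_diff G s f t))" for s
      using f by (simp_all add: left_diff_def right_diff_def)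
    then show ?case
      using Suc.prems f by (auto intro: Suc.IH)
  qed
  show ?thesis
    using assms(4) finite_degree by (cases d) auto
qed

lemma (in group) conjugation_hom:
  assumes "c \<in> carrier G"
  shows "(\<lambda>x. c \<otimes> x \<otimes> inv c) \<in> hom G G"
proof (rule homI)
  fix x y
  assume "x \<in> carrier G" "y \<in> carrier G"
  then show "c \<otimes> (x \<otimes> y) \<otimes> inv c = (c \<otimes> x \<otimes> inv c) \<otimes> (c \<otimes> y \<otimes> inv c)"
    using assms by (simp add: m_assoc inv_solve_left)
qed (use assms in simp)

lemma poly_map_deg_le_conjugate:
  assumes "group G" "c \<in> carrier G" "poly_map_deg_le G d f"
  shows "poly_map_deg_le G d (\<lambda>t. c \<otimes>\<^bsub>G\<^esub> f t \<otimes>\<^bsub>G\<^esub> inv\<^bsub>G\<^esub> c)"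
  using poly_map_deg_le_hom[OF assms(1,1) group.conjugation_hom[OF assms(1,2)] assms(3)] .

text \<open>
  The bound is a natural number because the translate of the trivial map, of degree \<open>-\<infinity>\<close>, is the
  constant \<open>c\<close>. In positive degree, \<open>c\<close> cancels from the right difference and conjugates the left one.
\<close>

lemma poly_map_deg_le_left_translate:
  fixes G (structure)
  assumes "group G" "c \<in> carrier G" "poly_map_deg_le G (Some n) f"
  shows "poly_map_deg_le G (Some n) (\<lambda>t. c \<otimes> f t)"
proof -
  interpret group G by fact
  have f: "f t \<in> carrier G" for t
    using poly_map_deg_le_closed[OF assms(1,3)] .
  show ?thesis
  proof (cases n)
    case 0
    then show ?thesis
      using assms by (auto simp: poly_map_deg_le_zero_iff simp del: poly_map_deg_le.simps)
  next
    case (Suc m)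
    have cancel: "inv c \<otimes> (c \<otimes> x) = x" if "x \<in> carrier G" for x
      using that assms(2) by (simp add: m_assoc[symmetric])
    have "left_diff G s (\<lambda>t. c \<otimes> f t) = (\<lambda>t. c \<otimes> left_diff G s f t \<otimes> inv c)"
      and "right_diff G s (\<lambda>t. c \<otimes> f t) = right_diff G s f" for s
      using f assms(2)
      by (simp_all add: left_diff_def right_diff_def inv_mult_group m_assoc cancel)
    then show ?thesis
      using assms f Suc by (auto intro: poly_map_deg_le_conjugate)
  qed
qed

lemma poly_map_deg_le_right_translate:
  fixes G (structure)
  assumes "group G" "c \<in> carrier G" "poly_map_deg_le G (Some n) f"
  shows "poly_map_deg_le G (Some n) (\<lambda>t. f t \<otimes> c)"
proof -
  interpret group G by fact
  have f: "f t \<in> carrier G" for t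
    using poly_map_deg_le_closed[OF assms(1,3)] .
  have "poly_map_deg_le G (Some n) (\<lambda>t. inv c \<otimes> (c \<otimes> f t) \<otimes> inv (inv c))"
    using assms by (intro poly_map_deg_le_conjugate poly_map_deg_le_left_translate) simp_all
  moreover have "(\<lambda>t. inv c \<otimes> (c \<otimes> f t) \<otimes> inv (inv c)) = (\<lambda>t. f t \<otimes> c)"
    using assms(2) f by (simp add: m_assoc[symmetric])
  ultimately show ?thesis
    by simp
qed

theorem corollary2:
  fixes G :: "('g, 'b) monoid_scheme" (structure)
    and f :: 'g
    and f' :: "'s::ab_semigroup_add \<Rightarrow> 'g"
    and k k' :: nat
    and d' :: "nat option"
  assumes "group G"
    and "1 \<le> k" and "1 \<le> k'"
    and "f \<in> carrier G - {\<one>}"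
    and "f \<in> lower_central G k"
    and "lc_height_ge G k' f'"
    and "poly_map_deg_le G d' f'"
  shows "lc_height_ge G (min k k') (\<lambda>t. f \<otimes> f' t)
       \<and> poly_map_deg_le G (max (Some 0) d') (\<lambda>t. f \<otimes> f' t)
       \<and> lc_height_ge G (min k k') (\<lambda>t. f' t \<otimes> f)
       \<and> poly_map_deg_le G (max (Some 0) d') (\<lambda>t. f' t \<otimes> f)"
proof -
  have f: "f \<in> carrier G"
    using assms(4) by simp
  obtain n where n: "max (Some 0) d' = Some n"
    by (cases d') (auto simp: max_def)
  have "d' \<le> Some n"
    by (metis n max.cobounded2)
  then have degree: "poly_map_deg_le G (Some n) f'"
    by (rule poly_map_deg_le_mono[OF assms(1,7)])
  have "lc_height_ge G k (\<lambda>t::'s. f)"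
    using assms(5) by (auto simp: lc_height_ge_def)
  then have heights: "lc_height_ge G (min k k') (\<lambda>t::'s. f)" "lc_height_ge G (min k k') f'"
    using assms(6) lc_height_ge_antimono[OF assms(1)] by (metis min.cobounded1 min.cobounded2)+
  show ?thesis
    unfolding n
    using lc_height_ge_mult[OF assms(1) heights(1,2)] lc_height_ge_mult[OF assms(1) heights(2,1)]
      poly_map_deg_le_left_translate[OF assms(1) f degree]
      poly_map_deg_le_right_translate[OF assms(1) f degree]
    by blast
qed

end
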